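(* Let $\mathbf m=(m_1,m_2,m_1',m_2',m_1'',m_2'')$ be positive integers with $d_{\mathbf m}>0$, with associated parameters $\xi_1,\dots,\xi_6$ ($\xi_6=0$), $\Lambda,\xi_a,\xi_b$ and matrices $X_{\mathbf m},Y_{\mathbf m}$. Relabel the elements within $\{\xi_1,\xi_2,\xi_3\}$ and within $\{\xi_4,\xi_5\}$ so that $\xi_a=\min\{\xi_1,\xi_2\}$ and $\xi_b=\max\{\xi_5,\xi_6\}$ (this changes neither $X_{\mathbf m}$ nor $Y_{\mathbf m}$). Let $H_1,H_2$ be the Hahn matrices of size $N=d_{\mathbf m}=\xi_a-\xi_b$ in which each $\eta_i$ is replaced by $\xi_i$, and $H_3=[H_1,H_2]$. Then $$X_{\mathbf m}=z_0+z_1H_1+z_2H_2+z_3H_3+z_4\{H_1,H_2\},$$ $$Y_{\mathbf m}=z_5+z_6H_1+z_7H_2+z_8H_3+z_9\{H_1,H_2\}+z_{10}H_1^2+z_{11}H_1^2H_2+z_{12}H_1H_2H_1,$$ where $\{A,B\}=AB+BA$, scalars stand for multiples of the identity, and, writing $S_k=\xi_1^k+\xi_2^k+\xi_5^k+\xi_6^k$, $$A_2=\tfrac12(1-S_2)+\tfrac18S_1^2,\qquad A_3=-\tfrac14(\xi_1+\xi_2-\xi_5-\xi_6)\bigl((\xi_1-\xi_2)^2-(\xi_5-\xi_6)^2\bigr),$$ the coefficients are $$z_2=\tfrac{\xi_3+\xi_4}2-\tfrac{S_1}4,\quad z_3=\tfrac{\xi_3-\xi_4}2,\quad z_1=z_3^2-\tfrac{\Lambda^2}4,\quad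 z_4=\tfrac12,$$ $$z_0=\tfrac{A_3}4-\tfrac{z_2}3\Bigl(\tfrac{\Lambda^2}4+z_3^2-\tfrac{2z_2^2}9-A_2-\tfrac12\Bigr),$$ $$z_5=\tfrac{z_3(A_2\Lambda+z_3)}3-\tfrac{z_2A_3}3-\tfrac{A_2(\Lambda-2z_3+4)(\Lambda-2z_3+2)}{24}-\tfrac{(\Lambda^2-4-4z_3^2)^2}{192}-\tfrac{A_3S_1}8-\tfrac{(2A_2-1)S_1^2-S_2^2}{48}-\tfrac{S_4}{12},$$ $$z_6=\tfrac{(4z_3^2-\Lambda^2)z_2}6-\tfrac{A_3}2,\quad z_7=\tfrac{(\Lambda+1)(2z_3-1)}4-\tfrac{z_2^2}3,\quad z_8=\tfrac{(3\Lambda-2z_3)z_2}6,\quad z_9=-\tfrac{2z_2}3,$$ $$z_{10}=\tfrac{(2z_3-\Lambda)(\Lambda+2-2z_3)}4,\quad z_{11}=\tfrac\Lambda2-z_3,\quad z_{12}=z_3-\tfrac\Lambda2-1.$$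
   Context: Parameters attached to $\mathbf m$: $\ell=\frac13(m_1+2m_2+m_1'+2m_2'-m_1''-2m_2'')$, $n=\frac13(2m_1+m_2+2m_1'+m_2'-2m_1''-m_2'')$; $(\xi_1,\xi_2,\xi_3)=(\ell,m_2,m_1'+\ell-n)$ if $\ell\le n$ and $(n,m_1',m_2+n-\ell)$ if $n\le\ell$; $(\xi_4,\xi_5,\xi_6)=(\ell-m_2',n-m_1,0)$; $\Lambda=\sum_{i=1}^3\xi_i-\sum_{i=4}^6\xi_i+2|\ell-n|$; $\lambda_\pm=\pm\frac12\Lambda+\frac16\sum_{i=1}^6\xi_i$; $\xi_a=\min\{\xi_1,\xi_2,\xi_3\}$; $\xi_b=\max\{\xi_4,\xi_5,\xi_6\}$. $d_{\mathbf m}$ is the multiplicity of the $\mathfrak{su}_3$-irreducible $[m_1'',m_2'']$ in $[m_1,m_2]\otimes[m_1',m_2']$, where $[m_1,m_2]$ has highest weight with Dynkin labels $(m_1-1,m_2-1)$; when it is non-zero it equals $\xi_a-\xi_b$. $X_{\mathbf m}=(a_{ij})$ and $Y_{\mathbf m}=(b_{ij})$ are the $d\times d$ ($d=d_{\mathbf m}$) tridiagonal matrices with $a_{j,j+1}=\prod_{i=1}^3(j+\xi_b-\xi_i)$, $b_{j,j+1}=a_{j,j+1}(j+\xi_b-\lambda_-)$, $a_{j+1,j}=\prod_{i=4}^6(j+\xi_b-\xi_i)$, $b_{j+1,j}=a_{j+1,j}(j+\xi_b-\lambda_+)$ for $1\le j\le d-1$, and, with $E_{j,k}=\sum_{i=1}^6(\xi_i-j-\xi_b+\frac12)^k$,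 for $1\le j\le d$, $$a_{jj}=-\tfrac1{108}\bigl(\tfrac72E_{j,1}^3-18E_{j,1}E_{j,2}+18E_{j,3}\bigr)-\tfrac1{24}E_{j,1}(\Lambda^2+2),$$ $$b_{jj}=\tfrac1{288}\bigl(\tfrac52E_{j,1}^4+32E_{j,1}E_{j,3}+6(E_{j,2}^2-3E_{j,1}^2E_{j,2}-4E_{j,4})+6E_{j,2}(\Lambda^2+2)-3E_{j,1}^2(\Lambda^2-2)-\tfrac32\Lambda^4+6\Lambda^2-36\bigr).$$ Hahn matrices: given parameters $\eta_1,\eta_2,\eta_5,\eta_6$ with $\eta_a=\min\{\eta_1,\eta_2\}$, $\eta_b=\max\{\eta_5,\eta_6\}$, $N=\eta_a-\eta_b$ a positive integer, $$H_1=\mathrm{diag}(0,-1,\dots,-N+1)+\Bigl(\tfrac{\eta_1+\eta_2+\eta_5+\eta_6-2}4-\eta_b\Bigr)\mathbf 1_N,$$ and $H_2=(\alpha_{ij})$ is the $N\times N$ tridiagonal matrix with entries given by $$\alpha_{j,j+1}=-(j+\eta_b-\eta_1)(j+\eta_b-\eta_2),\qquad \alpha_{j+1,j}=-(j+\eta_b-\eta_5)(j+\eta_b-\eta_6),$$ $$\alpha_{jj}=\alpha_{j,j-1}+\alpha_{j,j+1}+\tfrac14(\eta_1+\eta_2-\eta_5-\eta_6)(\eta_1+\eta_2-\eta_5-\eta_6-2),$$ where in the last formula $\alpha_{1,0}$ and $\alpha_{N,N+1}$ are given by the same expressions (and vanish). *)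

theory Defs
  imports
    "HOL-Combinatorics.Permutations"
    "Jordan_Normal_Form.VS_Connect"
    "Jordan_Normal_Form.Schur_Decomposition"
begin

section \<open>Multiplicities in tensor products of irreducible representations of \<open>su\<^sub>3\<close>\<close>

text \<open>A representation on the space of complex column vectors of length \<open>n\<close> is a function on
  matrices; only its values on \<open>su3\<close> matter.\<close>

definition su3 :: "complex mat set" where
  "su3 = {A \<in> carrier_mat 3 3. mat_adjoint A = - A \<and> (\<Sum>i<3. A $$ (i, i)) = 0}"

type_synonym su3_action = "complex mat \<Rightarrow> complex mat"

definition su3_rep :: "nat \<Rightarrow> su3_action \<Rightarrow> bool" where
  "su3_rep n \<rho> \<longleftrightarrow>
     (\<forall>A\<in>su3. \<rho> A \<in> carrier_mat n n) \<and>
     (\<forall>A\<in>su3. \<forall>B\<in>su3. \<rho> (A + B) = \<rho> A + \<rho> B) \<and>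
     (\<forall>A\<in>su3. \<forall>c::real. \<rho> (of_real c \<cdot>\<^sub>m A) = of_real c \<cdot>\<^sub>m \<rho> A) \<and>
     (\<forall>A\<in>su3. \<forall>B\<in>su3. \<rho> (A * B - B * A) = \<rho> A * \<rho> B - \<rho> B * \<rho> A)"

definition su3_irrep :: "nat \<Rightarrow> su3_action \<Rightarrow> bool" where
  "su3_irrep n \<rho> \<longleftrightarrow> su3_rep n \<rho> \<and> n > 0 \<and>
     (\<forall>W. VectorSpace.subspace class_ring W (module_vec TYPE(complex) n) \<longrightarrow>
          (\<forall>A\<in>su3. \<forall>w\<in>W. \<rho> A *\<^sub>v w \<in> W) \<longrightarrow>
          W = {0\<^sub>v n} \<or> W = carrier_vec n)"

definition su3_equiv :: "su3_action \<Rightarrow> su3_action \<Rightarrow> bool" where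
  "su3_equiv \<rho> \<sigma> \<longleftrightarrow>
     (\<exists>n. \<exists>P\<in>carrier_mat n n. invertible_mat P \<and>
        (\<forall>A\<in>su3. \<rho> A \<in> carrier_mat n n \<and> \<sigma> A \<in> carrier_mat n n \<and> P * \<rho> A = \<sigma> A * P))"

text \<open>The complex-linear extension of \<open>\<rho>\<close> to all traceless matrices, through the decomposition
  \<open>X = (X - X\<^sup>*)/2 + \<i> (X + X\<^sup>*)/(2\<i>)\<close> with both \<open>(X - X\<^sup>*)/2\<close> and \<open>(X + X\<^sup>*)/(2\<i>)\<close> in \<open>su3\<close>.\<close>

definition su3_ext :: "su3_action \<Rightarrow> su3_action" where
  "su3_ext \<rho> X = \<rho> ((1/2) \<cdot>\<^sub>m (X - mat_adjoint X))
                  + \<i> \<cdot>\<^sub>m \<rho> ((1 / (2 * \<i>)) \<cdot>\<^sub>m (X + mat_adjoint X))"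

text \<open>Rows and columns are numbered from 0.\<close>

definition elem_mat :: "nat \<Rightarrow> nat \<Rightarrow> complex mat" where
  "elem_mat a b = mat 3 3 (\<lambda>(i, j). if i = a \<and> j = b then 1 else 0)"

definition su3_irrep_hw :: "nat \<Rightarrow> nat \<Rightarrow> nat \<Rightarrow> su3_action \<Rightarrow> bool" where
  "su3_irrep_hw k l n \<rho> \<longleftrightarrow> su3_irrep n \<rho> \<and>
     (\<exists>v\<in>carrier_vec n. v \<noteq> 0\<^sub>v n \<and>
        su3_ext \<rho> (elem_mat 0 1) *\<^sub>v v = 0\<^sub>v n \<and>
        su3_ext \<rho> (elem_mat 1 2) *\<^sub>v v = 0\<^sub>v n \<and>
        su3_ext \<rho> (elem_mat 0 0 - elem_mat 1 1) *\<^sub>v v = of_nat k \<cdot>\<^sub>v v \<and>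
        su3_ext \<rho> (elem_mat 1 1 - elem_mat 2 2) *\<^sub>v v = of_nat l \<cdot>\<^sub>v v)"

definition kronecker :: "'a::semiring_1 mat \<Rightarrow> 'a mat \<Rightarrow> 'a mat" where
  "kronecker A B = mat (dim_row A * dim_row B) (dim_col A * dim_col B)
     (\<lambda>(i, j). A $$ (i div dim_row B, j div dim_col B) * B $$ (i mod dim_row B, j mod dim_col B))"

definition su3_tensor :: "nat \<Rightarrow> su3_action \<Rightarrow> nat \<Rightarrow> su3_action \<Rightarrow> su3_action" where
  "su3_tensor n \<rho> n' \<rho>' = (\<lambda>A. kronecker (\<rho> A) (1\<^sub>m n') + kronecker (1\<^sub>m n) (\<rho>' A))"

text \<open>\<open>d\<close> of the summands in a decomposition of \<open>\<tau>\<close> into irreducibles are equivalent to \<open>\<sigma>\<close>.\<close>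

definition has_multiplicity :: "su3_action \<Rightarrow> su3_action \<Rightarrow> nat \<Rightarrow> bool" where
  "has_multiplicity \<tau> \<sigma> d \<longleftrightarrow>
     (\<exists>\<rho>s. (\<forall>\<rho>\<in>set \<rho>s. \<exists>k. su3_irrep k \<rho>) \<and>
           su3_equiv \<tau> (\<lambda>A. diag_block_mat (map (\<lambda>\<rho>. \<rho> A) \<rho>s)) \<and>
           d = length (filter (\<lambda>\<rho>. su3_equiv \<rho> \<sigma>) \<rho>s))"

record su3_labels =
  m1 :: nat
  m2 :: nat
  m1' :: nat
  m2' :: nat
  m1'' :: nat
  m2'' :: nat

text \<open>Highest weights are shifted by one: the label \<open>[m1, m2]\<close> stands for the Dynkin labels
  \<open>(m1 - 1, m2 - 1)\<close>. The number does not depend on the representations chosen for the labels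
  nor on the decomposition.\<close>

definition su3_mult :: "su3_labels \<Rightarrow> nat" where
  "su3_mult m = (THE d. \<exists>n \<rho> n' \<rho>' n'' \<rho>''.
     su3_irrep_hw (m1 m - 1) (m2 m - 1) n \<rho> \<and>
     su3_irrep_hw (m1' m - 1) (m2' m - 1) n' \<rho>' \<and>
     su3_irrep_hw (m1'' m - 1) (m2'' m - 1) n'' \<rho>'' \<and>
     has_multiplicity (su3_tensor n \<rho> n' \<rho>') \<rho>'' d)"

section \<open>The parameters\<close>

definition par_l :: "su3_labels \<Rightarrow> real" where
  "par_l m = (real (m1 m) + 2 * real (m2 m) + real (m1' m) + 2 * real (m2' m)
              - real (m1'' m) - 2 * real (m2'' m)) / 3"

definition par_n :: "su3_labels \<Rightarrow> real" where
  "par_n m = (2 * real (m1 m) + real (m2 m) + 2 * real (m1' m) + real (m2' m)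
              - 2 * real (m1'' m) - real (m2'' m)) / 3"

text \<open>For \<open>par_l m = par_n m\<close> the two branches differ by exchanging \<open>\<xi>\<^sub>2\<close> and \<open>\<xi>\<^sub>3\<close> only, which
  is immaterial for everything below. Only the indices 1 to 6 are meaningful.\<close>

definition xi :: "su3_labels \<Rightarrow> nat \<Rightarrow> real" where
  "xi m i =
     ((if par_l m \<le> par_n m
       then [par_l m, real (m2 m), real (m1' m) + par_l m - par_n m]
       else [par_n m, real (m1' m), real (m2 m) + par_n m - par_l m])
      @ [par_l m - real (m2' m), par_n m - real (m1 m), 0]) ! (i - 1)"

definition Lam :: "su3_labels \<Rightarrow> real" where
  "Lam m = (\<Sum>i=1..3. xi m i) - (\<Sum>i=4..6. xi m i) + 2 * \<bar>par_l m - par_n m\<bar>"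

definition xi_a :: "(nat \<Rightarrow> real) \<Rightarrow> real" where
  "xi_a \<xi> = Min {\<xi> 1, \<xi> 2, \<xi> 3}"

definition xi_b :: "(nat \<Rightarrow> real) \<Rightarrow> real" where
  "xi_b \<xi> = Max {\<xi> 4, \<xi> 5, \<xi> 6}"

section \<open>The matrices\<close>

text \<open>Matrix entries are numbered from 0 by the library; the three functions below are indexed from
  1: \<open>up j\<close> is the entry \<open>(j, j+1)\<close>, \<open>low j\<close> the entry \<open>(j+1, j)\<close> and \<open>dg j\<close> the entry
  \<open>(j, j)\<close>.\<close>

definition tridiag_mat ::
    "nat \<Rightarrow> (nat \<Rightarrow> real) \<Rightarrow> (nat \<Rightarrow> real) \<Rightarrow> (nat \<Rightarrow> real) \<Rightarrow> real mat" where
  "tridiag_mat d up low dg = mat d d (\<lambda>(i, k).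
     if k = i + 1 then up (i + 1)
     else if i = k + 1 then low (k + 1)
     else if i = k then dg (i + 1)
     else 0)"

text \<open>In the following definitions \<open>L\<close> stands for \<open>\<Lambda>\<close>.\<close>

definition lam_plus :: "(nat \<Rightarrow> real) \<Rightarrow> real \<Rightarrow> real" where
  "lam_plus \<xi> L = L / 2 + (\<Sum>i=1..6. \<xi> i) / 6"

definition lam_minus :: "(nat \<Rightarrow> real) \<Rightarrow> real \<Rightarrow> real" where
  "lam_minus \<xi> L = - L / 2 + (\<Sum>i=1..6. \<xi> i) / 6"

definition E_sum :: "(nat \<Rightarrow> real) \<Rightarrow> nat \<Rightarrow> nat \<Rightarrow> real" where
  "E_sum \<xi> j k = (\<Sum>i=1..6. (\<xi> i - real j - xi_b \<xi> + 1/2) ^ k)"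

definition X_up :: "(nat \<Rightarrow> real) \<Rightarrow> nat \<Rightarrow> real" where
  "X_up \<xi> j = (\<Prod>i=1..3. real j + xi_b \<xi> - \<xi> i)"

definition X_low :: "(nat \<Rightarrow> real) \<Rightarrow> nat \<Rightarrow> real" where
  "X_low \<xi> j = (\<Prod>i=4..6. real j + xi_b \<xi> - \<xi> i)"

definition X_diag :: "(nat \<Rightarrow> real) \<Rightarrow> real \<Rightarrow> nat \<Rightarrow> real" where
  "X_diag \<xi> L j =
     - (1/108) * (7/2 * E_sum \<xi> j 1 ^ 3 - 18 * E_sum \<xi> j 1 * E_sum \<xi> j 2 + 18 * E_sum \<xi> j 3)
     - (1/24) * E_sum \<xi> j 1 * (L\<^sup>2 + 2)"

definition Y_diag :: "(nat \<Rightarrow> real) \<Rightarrow> real \<Rightarrow> nat \<Rightarrow> real" where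
  "Y_diag \<xi> L j = (1/288) *
     (5/2 * E_sum \<xi> j 1 ^ 4 + 32 * E_sum \<xi> j 1 * E_sum \<xi> j 3
      + 6 * (E_sum \<xi> j 2 ^ 2 - 3 * E_sum \<xi> j 1 ^ 2 * E_sum \<xi> j 2 - 4 * E_sum \<xi> j 4)
      + 6 * E_sum \<xi> j 2 * (L\<^sup>2 + 2) - 3 * E_sum \<xi> j 1 ^ 2 * (L\<^sup>2 - 2)
      - 3/2 * L ^ 4 + 6 * L\<^sup>2 - 36)"

definition X_mat :: "nat \<Rightarrow> (nat \<Rightarrow> real) \<Rightarrow> real \<Rightarrow> real mat" where
  "X_mat d \<xi> L = tridiag_mat d (X_up \<xi>) (X_low \<xi>) (X_diag \<xi> L)"

definition Y_mat :: "nat \<Rightarrow> (nat \<Rightarrow> real) \<Rightarrow> real \<Rightarrow> real mat" where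
  "Y_mat d \<xi> L = tridiag_mat d
     (\<lambda>j. X_up \<xi> j * (real j + xi_b \<xi> - lam_minus \<xi> L))
     (\<lambda>j. X_low \<xi> j * (real j + xi_b \<xi> - lam_plus \<xi> L))
     (Y_diag \<xi> L)"

text \<open>The Hahn matrices. Their size \<open>N\<close> is an explicit argument, meant to be
  \<open>min \<eta>\<^sub>1 \<eta>\<^sub>2 - max \<eta>\<^sub>5 \<eta>\<^sub>6\<close>. In \<open>hahn_diag\<close>, which is only used for \<open>j \<ge> 1\<close>, the number
  \<open>\<alpha>\<^sub>1\<^sub>,\<^sub>0\<close> is \<open>hahn_low \<dots> 0\<close>.\<close>

definition hahn_H1 :: "nat \<Rightarrow> real \<Rightarrow> real \<Rightarrow> real \<Rightarrow> real \<Rightarrow> real mat" where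
  "hahn_H1 N \<eta>1 \<eta>2 \<eta>5 \<eta>6 =
     mat N N (\<lambda>(i, k). if i = k then - real i else 0)
     + ((\<eta>1 + \<eta>2 + \<eta>5 + \<eta>6 - 2) / 4 - max \<eta>5 \<eta>6) \<cdot>\<^sub>m 1\<^sub>m N"

definition hahn_up :: "real \<Rightarrow> real \<Rightarrow> real \<Rightarrow> real \<Rightarrow> nat \<Rightarrow> real" where
  "hahn_up \<eta>1 \<eta>2 \<eta>5 \<eta>6 j = - (real j + max \<eta>5 \<eta>6 - \<eta>1) * (real j + max \<eta>5 \<eta>6 - \<eta>2)"

definition hahn_low :: "real \<Rightarrow> real \<Rightarrow> real \<Rightarrow> real \<Rightarrow> nat \<Rightarrow> real" where
  "hahn_low \<eta>1 \<eta>2 \<eta>5 \<eta>6 j = - (real j + max \<eta>5 \<eta>6 - \<eta>5) * (real j + max \<eta>5 \<eta>6 - \<eta>6)"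

definition hahn_diag :: "real \<Rightarrow> real \<Rightarrow> real \<Rightarrow> real \<Rightarrow> nat \<Rightarrow> real" where
  "hahn_diag \<eta>1 \<eta>2 \<eta>5 \<eta>6 j =
     hahn_low \<eta>1 \<eta>2 \<eta>5 \<eta>6 (j - 1) + hahn_up \<eta>1 \<eta>2 \<eta>5 \<eta>6 j
     + (1/4) * (\<eta>1 + \<eta>2 - \<eta>5 - \<eta>6) * (\<eta>1 + \<eta>2 - \<eta>5 - \<eta>6 - 2)"

definition hahn_H2 :: "nat \<Rightarrow> real \<Rightarrow> real \<Rightarrow> real \<Rightarrow> real \<Rightarrow> real mat" where
  "hahn_H2 N \<eta>1 \<eta>2 \<eta>5 \<eta>6 =
     tridiag_mat N (hahn_up \<eta>1 \<eta>2 \<eta>5 \<eta>6) (hahn_low \<eta>1 \<eta>2 \<eta>5 \<eta>6) (hahn_diag \<eta>1 \<eta>2 \<eta>5 \<eta>6)"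

definition commutator :: "real mat \<Rightarrow> real mat \<Rightarrow> real mat" where
  "commutator A B = A * B - B * A"

definition anticommutator :: "real mat \<Rightarrow> real mat \<Rightarrow> real mat" where
  "anticommutator A B = A * B + B * A"

end

(* H1 is diagonal and H2 is tridiagonal, so every word linear in H2 that occurs is again tridiagonal,
   with the entries of H2 multiplied by polynomials in the diagonal entries of H1. The theorem thus
   reduces to one polynomial identity for each of the three diagonals of X and Y, in the variable
   t = j + xi_b and with all parameters (including Lambda) free. Off the diagonal, the polynomial in
   H1 is linear for X and quadratic for Y, and splits into the missing factors t - xi_3 or t - xi_4
   and t - lambda. *)
theory Submission
  imports Defs
begin

section \<open>Polynomials in a diagonal and a tridiagonal matrix\<close>

lemma tridiag_mat_cong:
  assumes "\<And>j. 1 \<le> j \<Longrightarrow> j < d \<Longrightarrow> up j = up' j"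
    and "\<And>j. 1 \<le> j \<Longrightarrow> j < d \<Longrightarrow> low j = low' j"
    and "\<And>j. 1 \<le> j \<Longrightarrow> j \<le> d \<Longrightarrow> dg j = dg' j"
  shows "tridiag_mat d up low dg = tridiag_mat d up' low' dg'"
  unfolding tridiag_mat_def by (rule eq_matI) (auto intro!: assms)

text \<open>Multiplication by the diagonal matrix \<open>A\<close> scales rows from the left and
  columns from the right. Each word linear in \<open>B\<close> therefore multiplies entry
  \<open>(i, k)\<close> of \<open>B\<close> by a monomial in \<open>h (i+1)\<close> and
  \<open>h (k+1)\<close>. On the diagonal the commutator vanishes and the two cubic words
  agree.\<close>

lemma tridiag_mat_polynomial:
  fixes h up low dg :: "nat \<Rightarrow> real"
  assumes "A = mat_diag d (\<lambda>i. h (i + 1))" and "B = tridiag_mat d up low dg"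
  shows "c0 \<cdot>\<^sub>m 1\<^sub>m d + c1 \<cdot>\<^sub>m A + c2 \<cdot>\<^sub>m B + c3 \<cdot>\<^sub>m commutator A B + c4 \<cdot>\<^sub>m anticommutator A B
      + c5 \<cdot>\<^sub>m (A * A) + c6 \<cdot>\<^sub>m (A * A * B) + c7 \<cdot>\<^sub>m (A * B * A) =
    tridiag_mat d
      (\<lambda>j. up j * (c2 + c3 * (h j - h (j+1)) + c4 * (h j + h (j+1)) + c6 * (h j)\<^sup>2 + c7 * (h j * h (j+1))))
      (\<lambda>j. low j * (c2 + c3 * (h (j+1) - h j) + c4 * (h j + h (j+1)) + c6 * (h (j+1))\<^sup>2 + c7 * (h j * h (j+1))))
      (\<lambda>j. c0 + c1 * h j + c5 * (h j)\<^sup>2 + dg j * (c2 + 2 * c4 * h j + (c6 + c7) * (h j)\<^sup>2))"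
proof -
  have B: "B \<in> carrier_mat d d"
    unfolding assms tridiag_mat_def by simp
  have C: "mat d d f \<in> carrier_mat d d" for f :: "nat \<times> nat \<Rightarrow> real"
    by simp
  show ?thesis
    unfolding commutator_def anticommutator_def assms(1) mat_diag_diag
      mat_diag_mult_left[OF B] mat_diag_mult_right[OF B] mat_diag_mult_right[OF C]
    unfolding assms(2) tridiag_mat_def mat_diag_def
    by (rule eq_matI) (auto simp: algebra_simps power2_eq_square)
qed

text \<open>The final \<open>- 1\<close> is kept apart so that the entry depends on \<open>i\<close>
  only through the position \<open>real (i + 1) + max \<eta>5 \<eta>6\<close>, like the entries of
  the other Hahn matrix.\<close>

lemma hahn_H1_eq_mat_diag:
  "hahn_H1 N \<eta>1 \<eta>2 \<eta>5 \<eta>6 =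
    mat_diag N (\<lambda>i. (\<eta>1 + \<eta>2 + \<eta>5 + \<eta>6 - 2) / 4 - (real (i + 1) + max \<eta>5 \<eta>6 - 1))"
  unfolding hahn_H1_def mat_diag_def by (rule eq_matI) (auto simp: algebra_simps)

lemma sum_1_to_6: "(\<Sum>i=1..6::nat. f i) = f 1 + f 2 + f 3 + f 4 + f 5 + (f 6 :: 'a::comm_monoid_add)"
  by (simp add: numeral_eq_Suc ac_simps)

lemma prod_1_to_3: "(\<Prod>i=1..3::nat. f i) = f 1 * f 2 * (f 3 :: 'a::comm_monoid_mult)"
  by (simp add: numeral_eq_Suc ac_simps)

lemma prod_4_to_6: "(\<Prod>i=4..6::nat. f i) = f 4 * f 5 * (f 6 :: 'a::comm_monoid_mult)"
  by (simp add: numeral_eq_Suc ac_simps)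

section \<open>Invariance under relabelling within the two blocks of indices\<close>

context
  fixes \<xi> :: "nat \<Rightarrow> real" and r :: "nat \<Rightarrow> nat"
  assumes r13: "bij_betw r {1..3} {1..3}" and r46: "bij_betw r {4..6} {4..6}"
begin

lemma xi_b_relabel: "xi_b (\<xi> \<circ> r) = xi_b \<xi>"
proof -
  have s: "{4, 5, 6} = {4..6::nat}" by auto
  have "xi_b f = Max (f ` {4..6})" for f
    unfolding xi_b_def s[symmetric] by simp
  then show ?thesis
    using bij_betw_imp_surj_on[OF r46] by (simp only: image_comp[symmetric])
qed

lemma sum_relabel: "(\<Sum>i=1..6. f ((\<xi> \<circ> r) i)) = (\<Sum>i=1..6. f (\<xi> i))"
proof -
  have "bij_betw r ({1..3} \<union> {4..6}) ({1..3} \<union> {4..6})"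
    by (rule bij_betw_combine[OF r13 r46]) auto
  moreover have "{1..3} \<union> {4..6} = {1..6::nat}" by auto
  ultimately have "bij_betw r {1..6} {1..6}" by simp
  then show ?thesis
    unfolding comp_def by (rule sum.reindex_bij_betw)
qed

lemma X_up_relabel: "X_up (\<xi> \<circ> r) = X_up \<xi>"
  unfolding X_up_def xi_b_relabel unfolding o_apply
  by (rule ext) (rule prod.reindex_bij_betw[OF r13])

lemma X_low_relabel: "X_low (\<xi> \<circ> r) = X_low \<xi>"
  unfolding X_low_def xi_b_relabel unfolding o_apply
  by (rule ext) (rule prod.reindex_bij_betw[OF r46])

lemma E_sum_relabel: "E_sum (\<xi> \<circ> r) = E_sum \<xi>"
  unfolding E_sum_def xi_b_relabel
  by (intro ext) (rule sum_relabel)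

text \<open>The parameters enter only through products over one block, the maximum over the second
  block, and symmetric sums over all six indices.\<close>

lemma X_mat_relabel: "X_mat d (\<xi> \<circ> r) L = X_mat d \<xi> L"
  unfolding X_mat_def X_diag_def X_up_relabel X_low_relabel E_sum_relabel ..

lemma Y_mat_relabel: "Y_mat d (\<xi> \<circ> r) L = Y_mat d \<xi> L"
  unfolding Y_mat_def Y_diag_def X_up_relabel X_low_relabel E_sum_relabel
    lam_plus_def lam_minus_def sum_relabel[where f = "\<lambda>x. x"] xi_b_relabel ..

end

section \<open>Diagonal identities in centred coordinates\<close>

text \<open>Below, coordinates are taken relative to \<open>t - 1/2\<close>, where \<open>t\<close> is the position on the diagonal: \<open>A\<close> is the mean of
  \<open>\<xi>\<^sub>1, \<xi>\<^sub>2, \<xi>\<^sub>5, \<xi>\<^sub>6\<close>, which turns out to be the diagonal entry of \<open>H\<^sub>1\<close>; the deviations from it are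
  \<open>D \<plusminus> p\<close> for \<open>\<xi>\<^sub>1, \<xi>\<^sub>2\<close>, \<open>- D \<plusminus> q\<close> for \<open>\<xi>\<^sub>5, \<xi>\<^sub>6\<close> and \<open>z \<plusminus> c\<close> for \<open>\<xi>\<^sub>3, \<xi>\<^sub>4\<close>. The expansion of the
  identities for the diagonals is feasible only in such coordinates.\<close>

lemma centred_power_sums:
  fixes A D p q z c :: real
  defines "e \<equiv> \<lambda>k. (A + D + p) ^ k + (A + D - p) ^ k + (A + z + c) ^ k + (A + z - c) ^ k
    + (A - D + q) ^ k + (A - D - q) ^ k"
  shows "e 1 = 6 * A + 2 * z"
    and "e 2 = 4 * A\<^sup>2 + 4 * D\<^sup>2 + 2 * p\<^sup>2 + 2 * q\<^sup>2 + 2 * (A + z)\<^sup>2 + 2 * c\<^sup>2"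
    and "e 3 = 2 * (A + D) ^ 3 + 6 * (A + D) * p\<^sup>2 + 2 * (A + z) ^ 3 + 6 * (A + z) * c\<^sup>2
      + 2 * (A - D) ^ 3 + 6 * (A - D) * q\<^sup>2"
    and "e 4 = 2 * (A + D) ^ 4 + 12 * (A + D)\<^sup>2 * p\<^sup>2 + 2 * p ^ 4
      + 2 * (A + z) ^ 4 + 12 * (A + z)\<^sup>2 * c\<^sup>2 + 2 * c ^ 4
      + 2 * (A - D) ^ 4 + 12 * (A - D)\<^sup>2 * q\<^sup>2 + 2 * q ^ 4"
  unfolding e_def power_one_right by Groebner_Basis.algebra+

text \<open>Here \<open>z\<close>, \<open>c\<close> and \<open>v\<close> stand for
  \<open>z2\<close>, \<open>z3\<close> and the diagonal entry of \<open>H2\<close>, so the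
  right-hand side is \<open>z0 + z1 * A + v * (z2 + 2 * z4 * A)\<close> with
  \<open>2 * z4 = 1\<close>.\<close>

lemma centred_diag_X:
  fixes A D p q z c L :: real
  assumes "e1 = 6 * A + 2 * z"
    and "e2 = 4 * A\<^sup>2 + 4 * D\<^sup>2 + 2 * p\<^sup>2 + 2 * q\<^sup>2 + 2 * (A + z)\<^sup>2 + 2 * c\<^sup>2"
    and "e3 = 2 * (A + D) ^ 3 + 6 * (A + D) * p\<^sup>2 + 2 * (A + z) ^ 3 + 6 * (A + z) * c\<^sup>2
      + 2 * (A - D) ^ 3 + 6 * (A - D) * q\<^sup>2"
    and "v = 2 * D\<^sup>2 + p\<^sup>2 + q\<^sup>2 - 2 * A\<^sup>2 - 1/2"
    and "A3 = - 4 * D * (p\<^sup>2 - q\<^sup>2)"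
    and "A2 = 1/2 - 2 * D\<^sup>2 - p\<^sup>2 - q\<^sup>2"
  shows "- (1/108) * (7/2 * e1 ^ 3 - 18 * e1 * e2 + 18 * e3) - (1/24) * e1 * (L\<^sup>2 + 2) =
    A3 / 4 - z / 3 * (L\<^sup>2 / 4 + c\<^sup>2 - 2 * z\<^sup>2 / 9 - A2 - 1/2)
      + (c\<^sup>2 - L\<^sup>2 / 4) * A + v * (z + A)"
  unfolding assms by (simp add: field_simps power2_eq_square power3_eq_cube)

text \<open>\<open>K\<close> is the part of \<open>z5\<close> containing the power sums, up to sign,
  written in centred coordinates.\<close>

lemma centred_diag_Y:
  fixes A D p q z c L :: real
  assumes "e1 = 6 * A + 2 * z"
    and "e2 = 4 * A\<^sup>2 + 4 * D\<^sup>2 + 2 * p\<^sup>2 + 2 * q\<^sup>2 + 2 * (A + z)\<^sup>2 + 2 * c\<^sup>2"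
    and "e3 = 2 * (A + D) ^ 3 + 6 * (A + D) * p\<^sup>2 + 2 * (A + z) ^ 3 + 6 * (A + z) * c\<^sup>2
      + 2 * (A - D) ^ 3 + 6 * (A - D) * q\<^sup>2"
    and "e4 = 2 * (A + D) ^ 4 + 12 * (A + D)\<^sup>2 * p\<^sup>2 + 2 * p ^ 4
      + 2 * (A + z) ^ 4 + 12 * (A + z)\<^sup>2 * c\<^sup>2 + 2 * c ^ 4
      + 2 * (A - D) ^ 4 + 12 * (A - D)\<^sup>2 * q\<^sup>2 + 2 * q ^ 4"
    and "v = 2 * D\<^sup>2 + p\<^sup>2 + q\<^sup>2 - 2 * A\<^sup>2 - 1/2"
    and "A3 = - 4 * D * (p\<^sup>2 - q\<^sup>2)"
    and "A2 = 1/2 - 2 * D\<^sup>2 - p\<^sup>2 - q\<^sup>2"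
    and "K = (2 * (D ^ 4 + 6 * D\<^sup>2 * p\<^sup>2 + p ^ 4) + 2 * (D ^ 4 + 6 * D\<^sup>2 * q\<^sup>2 + q ^ 4)) / 12
      - (4 * D\<^sup>2 + 2 * p\<^sup>2 + 2 * q\<^sup>2)\<^sup>2 / 48"
  shows "(1/288) * (5/2 * e1 ^ 4 + 32 * e1 * e3
      + 6 * (e2\<^sup>2 - 3 * e1\<^sup>2 * e2 - 4 * e4)
      + 6 * e2 * (L\<^sup>2 + 2) - 3 * e1\<^sup>2 * (L\<^sup>2 - 2)
      - 3/2 * L ^ 4 + 6 * L\<^sup>2 - 36) =
    c * (A2 * L + c) / 3 - z * A3 / 3 - A2 * (L - 2 * c + 4) * (L - 2 * c + 2) / 24
      - (L\<^sup>2 - 4 - 4 * c\<^sup>2)\<^sup>2 / 192 - K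
      + ((4 * c\<^sup>2 - L\<^sup>2) * z / 6 - A3 / 2) * A
      + ((2 * c - L) * (L + 2 - 2 * c) / 4) * A\<^sup>2
      + v * ((L + 1) * (2 * c - 1) / 4 - z\<^sup>2 / 3 - 4 * z / 3 * A - A\<^sup>2)"
  unfolding assms
  by (simp add: field_simps power2_eq_square power3_eq_cube power4_eq_xxxx)

text \<open>The part of \<open>z\<^sub>5\<close> that involves \<open>S\<^sub>1\<close>, \<open>S\<^sub>2\<close>, \<open>S\<^sub>4\<close> is invariant under translations of the
  parameters; hence the mean \<open>s\<close> does not occur on the right.\<close>

lemma power_sum_part_translation_invariant:
  fixes s D p q :: real
  assumes "S1 = 4 * s"
    and "S2 = (s + D + p)\<^sup>2 + (s + D - p)\<^sup>2 + (s - D + q)\<^sup>2 + (s - D - q)\<^sup>2"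
    and "S4 = (s + D + p) ^ 4 + (s + D - p) ^ 4 + (s - D + q) ^ 4 + (s - D - q) ^ 4"
    and "A3 = - 4 * D * (p\<^sup>2 - q\<^sup>2)"
    and "A2 = 1/2 - 2 * D\<^sup>2 - p\<^sup>2 - q\<^sup>2"
  shows "A3 * S1 / 8 + ((2 * A2 - 1) * S1\<^sup>2 - S2\<^sup>2) / 48 + S4 / 12 =
    (2 * (D ^ 4 + 6 * D\<^sup>2 * p\<^sup>2 + p ^ 4) + 2 * (D ^ 4 + 6 * D\<^sup>2 * q\<^sup>2 + q ^ 4)) / 12
      - (4 * D\<^sup>2 + 2 * p\<^sup>2 + 2 * q\<^sup>2)\<^sup>2 / 48"
  unfolding assms by Groebner_Basis.algebra

section \<open>Entrywise identities for the coefficients\<close>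

locale hahn_coefficients =
  fixes \<xi> :: "nat \<Rightarrow> real" and S :: "nat \<Rightarrow> real"
    and L A2 A3 z0 z1 z2 z3 z4 z5 z6 z7 z8 z9 z10 z11 z12 :: real
  assumes xi_b_max: "xi_b \<xi> = max (\<xi> 5) (\<xi> 6)"
    and S_def: "\<And>k. S k = \<xi> 1 ^ k + \<xi> 2 ^ k + \<xi> 5 ^ k + \<xi> 6 ^ k"
    and A2_def: "A2 = (1/2) * (1 - S 2) + (1/8) * (S 1)\<^sup>2"
    and A3_def: "A3 = - (1/4) * (\<xi> 1 + \<xi> 2 - \<xi> 5 - \<xi> 6) * ((\<xi> 1 - \<xi> 2)\<^sup>2 - (\<xi> 5 - \<xi> 6)\<^sup>2)"
    and z2_def: "z2 = (\<xi> 3 + \<xi> 4) / 2 - S 1 / 4"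
    and z3_def: "z3 = (\<xi> 3 - \<xi> 4) / 2"
    and z1_def: "z1 = z3\<^sup>2 - L\<^sup>2 / 4"
    and z4_def: "z4 = 1/2"
    and z0_def: "z0 = A3 / 4 - z2 / 3 * (L\<^sup>2 / 4 + z3\<^sup>2 - 2 * z2\<^sup>2 / 9 - A2 - 1/2)"
    and z5_def: "z5 = z3 * (A2 * L + z3) / 3 - z2 * A3 / 3
                  - A2 * (L - 2 * z3 + 4) * (L - 2 * z3 + 2) / 24
                  - (L\<^sup>2 - 4 - 4 * z3\<^sup>2)\<^sup>2 / 192
                  - A3 * S 1 / 8 - ((2 * A2 - 1) * (S 1)\<^sup>2 - (S 2)\<^sup>2) / 48 - S 4 / 12"
    and z6_def: "z6 = (4 * z3\<^sup>2 - L\<^sup>2) * z2 / 6 - A3 / 2"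
    and z7_def: "z7 = (L + 1) * (2 * z3 - 1) / 4 - z2\<^sup>2 / 3"
    and z8_def: "z8 = (3 * L - 2 * z3) * z2 / 6"
    and z9_def: "z9 = - (2 * z2 / 3)"
    and z10_def: "z10 = (2 * z3 - L) * (L + 2 - 2 * z3) / 4"
    and z11_def: "z11 = L / 2 - z3"
    and z12_def: "z12 = z3 - L / 2 - 1"
begin

text \<open>\<open>h\<close> gives the diagonal of \<open>H1\<close>; \<open>u\<close>,
  \<open>w\<close> and \<open>v\<close> give the upper, lower and main diagonals of
  \<open>H2\<close>. All are extended to a real position \<open>t\<close>, so that the claims become
  polynomial identities.\<close>

definition h :: "real \<Rightarrow> real" where
  "h t = (\<xi> 1 + \<xi> 2 + \<xi> 5 + \<xi> 6 - 2) / 4 - (t - 1)"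

definition u :: "real \<Rightarrow> real" where
  "u t = - (t - \<xi> 1) * (t - \<xi> 2)"

definition w :: "real \<Rightarrow> real" where
  "w t = - (t - \<xi> 5) * (t - \<xi> 6)"

definition v :: "real \<Rightarrow> real" where
  "v t = w (t - 1) + u t
    + (1/4) * (\<xi> 1 + \<xi> 2 - \<xi> 5 - \<xi> 6) * (\<xi> 1 + \<xi> 2 - \<xi> 5 - \<xi> 6 - 2)"

definition e :: "real \<Rightarrow> nat \<Rightarrow> real" where
  "e t k = (\<Sum>i=1..6. (\<xi> i - t + 1/2) ^ k)"

text \<open>Since \<open>h t - h (t + 1) = 1\<close>, the commutator coefficient enters with
  opposite signs above and below the diagonal. For \<open>X\<close> this separates
  \<open>z2 + z3 = \<xi> 3 - S 1 / 4\<close> from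
  \<open>z2 - z3 = \<xi> 4 - S 1 / 4\<close>.\<close>

lemma coefficient_identities:
  fixes t :: real
  defines "s \<equiv> (\<xi> 1 + \<xi> 2 + \<xi> 3 + \<xi> 4 + \<xi> 5 + \<xi> 6) / 6"
  shows up_X: "(t - \<xi> 1) * (t - \<xi> 2) * (t - \<xi> 3) =
      u t * (z2 + z3 * (h t - h (t + 1)) + z4 * (h t + h (t + 1)))" (is ?upX)
    and low_X: "(t - \<xi> 4) * (t - \<xi> 5) * (t - \<xi> 6) =
      w t * (z2 + z3 * (h (t + 1) - h t) + z4 * (h t + h (t + 1)))" (is ?lowX)
    and up_Y: "(t - \<xi> 1) * (t - \<xi> 2) * (t - \<xi> 3) * (t - (- L / 2 + s)) =
      u t * (z7 + z8 * (h t - h (t + 1)) + z9 * (h t + h (t + 1)) + z11 * (h t)\<^sup>2 + z12 * (h t * h (t + 1)))" (is ?upY)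
    and low_Y: "(t - \<xi> 4) * (t - \<xi> 5) * (t - \<xi> 6) * (t - (L / 2 + s)) =
      w t * (z7 + z8 * (h (t + 1) - h t) + z9 * (h t + h (t + 1)) + z11 * (h (t + 1))\<^sup>2 + z12 * (h t * h (t + 1)))" (is ?lowY)
proof -
  \<comment> \<open>With \<open>h\<close> and \<open>s\<close> written through \<open>S 1\<close>,
    the cofactors of \<open>u t\<close> and \<open>w t\<close> involve only \<open>S 1\<close>,
    \<open>\<xi> 3\<close>, \<open>\<xi> 4\<close>, \<open>L\<close> and \<open>t\<close>.\<close>
  have S1: "S 1 = \<xi> 1 + \<xi> 2 + \<xi> 5 + \<xi> 6"
    by (simp add: S_def)
  have h: "h t = S 1 / 4 + 1/2 - t" "h (t + 1) = S 1 / 4 - 1/2 - t"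
    unfolding h_def S1 by (simp_all add: field_simps)
  have s: "s = (S 1 + \<xi> 3 + \<xi> 4) / 6"
    unfolding s_def S1 by (simp add: field_simps)
  have "z2 + z3 * (h t - h (t + 1)) + z4 * (h t + h (t + 1)) = - (t - \<xi> 3)"
    unfolding h z2_def z3_def z4_def by (simp add: field_simps)
  then show ?upX
    unfolding u_def by (simp only: mult_minus_left mult_minus_right minus_minus mult_ac)
  have "z2 + z3 * (h (t + 1) - h t) + z4 * (h t + h (t + 1)) = - (t - \<xi> 4)"
    unfolding h z2_def z3_def z4_def by (simp add: field_simps)
  then show ?lowX
    unfolding w_def by (simp only: mult_minus_left mult_minus_right minus_minus mult_ac)
  have "z7 + z8 * (h t - h (t + 1)) + z9 * (h t + h (t + 1)) + z11 * (h t)\<^sup>2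
      + z12 * (h t * h (t + 1)) = - (t - \<xi> 3) * (t - (- L / 2 + s))"
    unfolding h s z7_def z8_def z9_def z11_def z12_def z2_def z3_def
    by (simp add: field_simps power2_eq_square)
  then show ?upY
    unfolding u_def by (simp only: mult_minus_left mult_minus_right minus_minus mult_ac)
  have "z7 + z8 * (h (t + 1) - h t) + z9 * (h t + h (t + 1)) + z11 * (h (t + 1))\<^sup>2
      + z12 * (h t * h (t + 1)) = - (t - \<xi> 4) * (t - (L / 2 + s))"
    unfolding h s z7_def z8_def z9_def z11_def z12_def z2_def z3_def
    by (simp add: field_simps power2_eq_square)
  then show ?lowY
    unfolding w_def by (simp only: mult_minus_left mult_minus_right minus_minus mult_ac)
qed

context
  fixes t s D p q :: real
  defines "s \<equiv> (\<xi> 1 + \<xi> 2 + \<xi> 5 + \<xi> 6) / 4"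
    and "D \<equiv> (\<xi> 1 + \<xi> 2 - \<xi> 5 - \<xi> 6) / 4"
    and "p \<equiv> (\<xi> 1 - \<xi> 2) / 2"
    and "q \<equiv> (\<xi> 5 - \<xi> 6) / 2"
begin

text \<open>\<open>z2\<close> and \<open>z3\<close> are already centred coordinates: they serve as
  \<open>z\<close> and \<open>c\<close> above, and \<open>h t\<close> serves as
  \<open>A\<close>.\<close>

private lemma xi_centred: "\<xi> 1 = s + D + p" "\<xi> 2 = s + D - p" "\<xi> 5 = s - D + q" "\<xi> 6 = s - D - q"
    "\<xi> 3 = s + z2 + z3" "\<xi> 4 = s + z2 - z3"
  by (simp_all add: s_def D_def p_def q_def z2_def z3_def S_def field_simps)

private lemma h_centred: "h t = s - t + 1/2"
  by (simp add: h_def s_def field_simps)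

private lemma e_centred: "e t k = (h t + D + p) ^ k + (h t + D - p) ^ k
    + (h t + z2 + z3) ^ k + (h t + z2 - z3) ^ k + (h t - D + q) ^ k + (h t - D - q) ^ k"
  unfolding e_def sum_1_to_6 h_centred xi_centred by (simp add: algebra_simps)

private lemma v_centred: "v t = 2 * D\<^sup>2 + p\<^sup>2 + q\<^sup>2 - 2 * (h t)\<^sup>2 - 1/2"
  unfolding v_def u_def w_def h_centred xi_centred by Groebner_Basis.algebra

private lemma A3_centred: "A3 = - 4 * D * (p\<^sup>2 - q\<^sup>2)"
  unfolding A3_def xi_centred by Groebner_Basis.algebra

private lemma A2_centred: "A2 = 1/2 - 2 * D\<^sup>2 - p\<^sup>2 - q\<^sup>2"
  unfolding A2_def S_def xi_centred by Groebner_Basis.algebra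

private lemmas e_values = centred_power_sums[of "h t" D p z2 z3 q, folded e_centred]

lemma diag_X: "- (1/108) * (7/2 * e t 1 ^ 3 - 18 * e t 1 * e t 2 + 18 * e t 3)
     - (1/24) * e t 1 * (L\<^sup>2 + 2) = z0 + z1 * h t + v t * (z2 + 2 * z4 * h t)"
  using centred_diag_X[OF e_values(1-3) v_centred A3_centred A2_centred]
  by (simp add: z0_def z1_def z4_def)

lemma diag_Y: "(1/288) * (5/2 * e t 1 ^ 4 + 32 * e t 1 * e t 3
      + 6 * (e t 2 ^ 2 - 3 * e t 1 ^ 2 * e t 2 - 4 * e t 4)
      + 6 * e t 2 * (L\<^sup>2 + 2) - 3 * e t 1 ^ 2 * (L\<^sup>2 - 2)
      - 3/2 * L ^ 4 + 6 * L\<^sup>2 - 36) =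
    z5 + z6 * h t + z10 * (h t)\<^sup>2 + v t * (z7 + 2 * z9 * h t + (z11 + z12) * (h t)\<^sup>2)"
proof -
  have K: "A3 * S 1 / 8 + ((2 * A2 - 1) * (S 1)\<^sup>2 - (S 2)\<^sup>2) / 48 + S 4 / 12 =
    (2 * (D ^ 4 + 6 * D\<^sup>2 * p\<^sup>2 + p ^ 4) + 2 * (D ^ 4 + 6 * D\<^sup>2 * q\<^sup>2 + q ^ 4)) / 12
      - (4 * D\<^sup>2 + 2 * p\<^sup>2 + 2 * q\<^sup>2)\<^sup>2 / 48"
    by (rule power_sum_part_translation_invariant[where s = s, OF _ _ _ A3_centred A2_centred])
      (unfold S_def xi_centred, simp_all)
  \<comment> \<open>The quadratic coefficient simplifies because
    \<open>z11 + z12 = -1\<close>.\<close>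
  have v: "z7 + 2 * z9 * h t + (z11 + z12) * (h t)\<^sup>2 =
      (L + 1) * (2 * z3 - 1) / 4 - z2\<^sup>2 / 3 - 4 * z2 / 3 * h t - (h t)\<^sup>2"
    by (simp add: z7_def z9_def z11_def z12_def)
  show ?thesis
    unfolding centred_diag_Y[OF e_values v_centred A3_centred A2_centred K] v
    unfolding z5_def z6_def z10_def by simp
qed

end

section \<open>From entries to matrices\<close>

lemma hahn_H1_eq:
  "hahn_H1 d (\<xi> 1) (\<xi> 2) (\<xi> 5) (\<xi> 6) = mat_diag d (\<lambda>i. h (real (i + 1) + xi_b \<xi>))"
  by (simp add: hahn_H1_eq_mat_diag h_def xi_b_max)

lemma hahn_H2_eq:
  "hahn_H2 d (\<xi> 1) (\<xi> 2) (\<xi> 5) (\<xi> 6) = tridiag_mat d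
    (\<lambda>j. u (real j + xi_b \<xi>)) (\<lambda>j. w (real j + xi_b \<xi>)) (\<lambda>j. v (real j + xi_b \<xi>))"
  unfolding hahn_H2_def
  \<comment> \<open>The congruence rule supplies \<open>1 \<le> j\<close>, so the truncated
    \<open>j - 1\<close> in \<open>hahn_diag\<close> is a true difference.\<close>
  by (rule tridiag_mat_cong)
     (simp_all add: hahn_diag_def hahn_up_def hahn_low_def u_def v_def w_def xi_b_max of_nat_diff algebra_simps)

lemmas hahn_polynomial = tridiag_mat_polynomial
  [of _ _ "\<lambda>j. h (real j + xi_b \<xi>)", OF hahn_H1_eq hahn_H2_eq]

lemma E_sum_eq: "E_sum \<xi> j k = e (real j + xi_b \<xi>) k"
  unfolding E_sum_def e_def by (simp add: algebra_simps)

lemma X_mat_eq: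
  fixes d
  defines "H1 \<equiv> hahn_H1 d (\<xi> 1) (\<xi> 2) (\<xi> 5) (\<xi> 6)"
    and "H2 \<equiv> hahn_H2 d (\<xi> 1) (\<xi> 2) (\<xi> 5) (\<xi> 6)"
  shows "X_mat d \<xi> L = z0 \<cdot>\<^sub>m 1\<^sub>m d + z1 \<cdot>\<^sub>m H1 + z2 \<cdot>\<^sub>m H2 + z3 \<cdot>\<^sub>m commutator H1 H2
    + z4 \<cdot>\<^sub>m anticommutator H1 H2"
proof -
  have H: "H1 \<in> carrier_mat d d" "H2 \<in> carrier_mat d d"
    unfolding H1_def H2_def hahn_H1_eq hahn_H2_eq tridiag_mat_def by simp_all
  \<comment> \<open>Zero terms pad the sum to the eight-term shape of
    \<open>hahn_polynomial\<close>.\<close>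
  have "X_mat d \<xi> L = z0 \<cdot>\<^sub>m 1\<^sub>m d + z1 \<cdot>\<^sub>m H1 + z2 \<cdot>\<^sub>m H2 + z3 \<cdot>\<^sub>m commutator H1 H2
      + z4 \<cdot>\<^sub>m anticommutator H1 H2
      + 0 \<cdot>\<^sub>m (H1 * H1) + 0 \<cdot>\<^sub>m (H1 * H1 * H2) + 0 \<cdot>\<^sub>m (H1 * H2 * H1)"
    unfolding H1_def H2_def hahn_polynomial X_mat_def
  proof (rule tridiag_mat_cong, goal_cases)
    case (1 j)
    \<comment> \<open>This exposes \<open>t + 1\<close> for \<open>t = real j + xi_b \<xi>\<close>,
      as in \<open>up_X\<close>.\<close>
    have s: "real (j + 1) + xi_b \<xi> = real j + xi_b \<xi> + 1" by simp
    show ?case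
      unfolding X_up_def prod_1_to_3 s up_X by simp
  next
    case (2 j)
    have s: "real (j + 1) + xi_b \<xi> = real j + xi_b \<xi> + 1" by simp
    show ?case
      unfolding X_low_def prod_4_to_6 s low_X by simp
  next
    case (3 j)
    show ?case
      unfolding X_diag_def E_sum_eq diag_X by simp
  qed
  also have "\<dots> = z0 \<cdot>\<^sub>m 1\<^sub>m d + z1 \<cdot>\<^sub>m H1 + z2 \<cdot>\<^sub>m H2 + z3 \<cdot>\<^sub>m commutator H1 H2
      + z4 \<cdot>\<^sub>m anticommutator H1 H2"
    using H by (intro eq_matI) (auto simp: commutator_def anticommutator_def)
  finally show ?thesis .
qed

lemma Y_mat_eq:
  fixes d
  defines "H1 \<equiv> hahn_H1 d (\<xi> 1) (\<xi> 2) (\<xi> 5) (\<xi> 6)"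
    and "H2 \<equiv> hahn_H2 d (\<xi> 1) (\<xi> 2) (\<xi> 5) (\<xi> 6)"
  shows "Y_mat d \<xi> L = z5 \<cdot>\<^sub>m 1\<^sub>m d + z6 \<cdot>\<^sub>m H1 + z7 \<cdot>\<^sub>m H2 + z8 \<cdot>\<^sub>m commutator H1 H2
    + z9 \<cdot>\<^sub>m anticommutator H1 H2
    + z10 \<cdot>\<^sub>m (H1 * H1) + z11 \<cdot>\<^sub>m (H1 * H1 * H2) + z12 \<cdot>\<^sub>m (H1 * H2 * H1)"
  unfolding H1_def H2_def hahn_polynomial Y_mat_def
proof (rule tridiag_mat_cong, goal_cases)
  case (1 j)
  have s: "real (j + 1) + xi_b \<xi> = real j + xi_b \<xi> + 1" by simp
  show ?case
    unfolding X_up_def prod_1_to_3 lam_minus_def sum_1_to_6 s by (rule up_Y)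
next
  case (2 j)
  have s: "real (j + 1) + xi_b \<xi> = real j + xi_b \<xi> + 1" by simp
  show ?case
    unfolding X_low_def prod_4_to_6 lam_plus_def sum_1_to_6 s by (rule low_Y)
next
  case (3 j)
  show ?case
    unfolding Y_diag_def E_sum_eq by (rule diag_Y)
qed

end

section \<open>Application to the relabelled parameters of the multiplicity problem\<close>

theorem proposition1p4:
  fixes m :: su3_labels
    and p q :: "nat \<Rightarrow> nat"
    and \<xi> :: "nat \<Rightarrow> real"
    and d :: nat
    and L A2 A3 z0 z1 z2 z3 z4 z5 z6 z7 z8 z9 z10 z11 z12 :: real
    and S :: "nat \<Rightarrow> real"
    and X Y H1 H2 H3 :: "real mat"
  assumes pos: "m1 m > 0" "m2 m > 0" "m1' m > 0" "m2' m > 0" "m1'' m > 0" "m2'' m > 0"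
    and d_def: "d = su3_mult m"
    and d_pos: "d > 0"
    and L_def: "L = Lam m"
    and X_def: "X = X_mat d (xi m) L"
    and Y_def: "Y = Y_mat d (xi m) L"
    and relabel: "p permutes {1, 2, 3}" "q permutes {4, 5}" "\<xi> = xi m \<circ> p \<circ> q"
    and xi_a_min: "xi_a (xi m) = min (\<xi> 1) (\<xi> 2)"
    and xi_b_max: "xi_b (xi m) = max (\<xi> 5) (\<xi> 6)"
    and H1_def: "H1 = hahn_H1 d (\<xi> 1) (\<xi> 2) (\<xi> 5) (\<xi> 6)"
    and H2_def: "H2 = hahn_H2 d (\<xi> 1) (\<xi> 2) (\<xi> 5) (\<xi> 6)"
    and H3_def: "H3 = commutator H1 H2"
    and S_def: "\<And>k. S k = \<xi> 1 ^ k + \<xi> 2 ^ k + \<xi> 5 ^ k + \<xi> 6 ^ k"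
    and A2_def: "A2 = (1/2) * (1 - S 2) + (1/8) * (S 1)\<^sup>2"
    and A3_def: "A3 = - (1/4) * (\<xi> 1 + \<xi> 2 - \<xi> 5 - \<xi> 6) * ((\<xi> 1 - \<xi> 2)\<^sup>2 - (\<xi> 5 - \<xi> 6)\<^sup>2)"
    and z2_def: "z2 = (\<xi> 3 + \<xi> 4) / 2 - S 1 / 4"
    and z3_def: "z3 = (\<xi> 3 - \<xi> 4) / 2"
    and z1_def: "z1 = z3\<^sup>2 - L\<^sup>2 / 4"
    and z4_def: "z4 = 1/2"
    and z0_def: "z0 = A3 / 4 - z2 / 3 * (L\<^sup>2 / 4 + z3\<^sup>2 - 2 * z2\<^sup>2 / 9 - A2 - 1/2)"
    and z5_def: "z5 = z3 * (A2 * L + z3) / 3 - z2 * A3 / 3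
                  - A2 * (L - 2 * z3 + 4) * (L - 2 * z3 + 2) / 24
                  - (L\<^sup>2 - 4 - 4 * z3\<^sup>2)\<^sup>2 / 192
                  - A3 * S 1 / 8 - ((2 * A2 - 1) * (S 1)\<^sup>2 - (S 2)\<^sup>2) / 48 - S 4 / 12"
    and z6_def: "z6 = (4 * z3\<^sup>2 - L\<^sup>2) * z2 / 6 - A3 / 2"
    and z7_def: "z7 = (L + 1) * (2 * z3 - 1) / 4 - z2\<^sup>2 / 3"
    and z8_def: "z8 = (3 * L - 2 * z3) * z2 / 6"
    and z9_def: "z9 = - (2 * z2 / 3)"
    and z10_def: "z10 = (2 * z3 - L) * (L + 2 - 2 * z3) / 4"
    and z11_def: "z11 = L / 2 - z3"
    and z12_def: "z12 = z3 - L / 2 - 1"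
  shows "X_mat d \<xi> L = X \<and> Y_mat d \<xi> L = Y \<and>
    X = z0 \<cdot>\<^sub>m 1\<^sub>m d + z1 \<cdot>\<^sub>m H1 + z2 \<cdot>\<^sub>m H2 + z3 \<cdot>\<^sub>m H3 + z4 \<cdot>\<^sub>m anticommutator H1 H2 \<and>
    Y = z5 \<cdot>\<^sub>m 1\<^sub>m d + z6 \<cdot>\<^sub>m H1 + z7 \<cdot>\<^sub>m H2 + z8 \<cdot>\<^sub>m H3 + z9 \<cdot>\<^sub>m anticommutator H1 H2
        + z10 \<cdot>\<^sub>m (H1 * H1) + z11 \<cdot>\<^sub>m (H1 * H1 * H2) + z12 \<cdot>\<^sub>m (H1 * H2 * H1)"
proof -
  define r where "r = p \<circ> q"
  \<comment> \<open>Each permutation is the identity on the other's block, so the composite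
    preserves both blocks.\<close>
  have "bij_betw q {1..3} {1..3} \<longleftrightarrow> bij_betw id {1..3} {1..3::nat}"
    by (rule bij_betw_cong) (use permutes_not_in[OF relabel(2)] in auto)
  moreover have s13: "{1..3} = {1, 2, 3::nat}" by auto
  then have "bij_betw p {1..3} {1..3}"
    using permutes_imp_bij[OF relabel(1)] by simp
  ultimately have r13: "bij_betw r {1..3} {1..3}"
    unfolding r_def by (auto intro: bij_betw_trans)
  have "q permutes {4..6}"
    using relabel(2) by (rule permutes_subset) auto
  then have "bij_betw q {4..6} {4..6}"
    by (rule permutes_imp_bij)
  moreover have "bij_betw p {4..6} {4..6} \<longleftrightarrow> bij_betw id {4..6} {4..6::nat}"
    by (rule bij_betw_cong) (use permutes_not_in[OF relabel(1)] in auto)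
  ultimately have r46: "bij_betw r {4..6} {4..6}"
    unfolding r_def by (auto intro: bij_betw_trans)
  have \<xi>: "\<xi> = xi m \<circ> r"
    using relabel(3) by (simp add: r_def comp_assoc)
  interpret hahn_coefficients \<xi> S L A2 A3 z0 z1 z2 z3 z4 z5 z6 z7 z8 z9 z10 z11 z12
  proof unfold_locales
    \<comment> \<open>The hypothesis concerns \<open>xi m\<close>; invariance of \<open>xi_b\<close>
      transfers it to \<open>\<xi>\<close>.\<close>
    show "xi_b \<xi> = max (\<xi> 5) (\<xi> 6)"
      using xi_b_max unfolding \<xi> xi_b_relabel[OF r13 r46] .
  qed (fact assms)+
  show ?thesis
    using X_mat_relabel[OF r13 r46] Y_mat_relabel[OF r13 r46] X_mat_eq Y_mat_eq
    by (simp add: X_def Y_def H1_def H2_def H3_def \<xi>)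
qed

end
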